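(* Let $Y$ be a 2nd countable topological space, let $m$ be the completion of a finite regular Borel measure on $Y$, and let $m_e$ be its outer measure. Let $\{A_\gamma:\gamma\in\Gamma\}$ be a (pairwise) disjoint family of measure zero subsets of $Y$ and $E=\bigcup_{\gamma\in\Gamma}A_\gamma$. If $m_e(E)>0$, then there exists $\Delta\subset\Gamma$ such that $\bigcup_{\gamma\in\Delta}A_\gamma$ and $\bigcup_{\gamma\in\Gamma\setminus\Delta}A_\gamma$ cannot be separated by measurable sets.
   Context: Measurable means $m$-measurable, i.e. belonging to the domain of the completed measure $m$; measure zero means $m(A_\gamma)=0$. The outer measure is $m_e(A)=\inf\{m(C):A\subset C,\ C\text{ measurable}\}$. Two sets $F_1,F_2\subset Y$ cannot be separated by measurable sets if there is no measurable $G\subset Y$ with $F_1\subset G$ and $G\cap F_2=\emptyset$. *)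

theory Defs
  imports "HOL-Analysis.Analysis"
begin

(* Since no separation axiom is assumed, inner regularity is by closed sets.  For a finite
   measure the two approximation clauses are equivalent by taking complements; so a finite
   measure that is outer regular by open sets and inner regular by compact sets is also
   regular in the present sense. *)
definition regular_borel_measure :: "'a::topological_space measure \<Rightarrow> bool" where
  "regular_borel_measure M \<longleftrightarrow>
     sets M = sets borel \<and>
     (\<forall>B\<in>sets M.
        emeasure M B = (INF U\<in>{U. open U \<and> B \<subseteq> U}. emeasure M U) \<and>
        emeasure M B = (SUP C\<in>{C. closed C \<and> C \<subseteq> B}. emeasure M C))"

definition separable_by_measurable :: "'a measure \<Rightarrow> 'a set \<Rightarrow> 'a set \<Rightarrow> bool" where
  "separable_by_measurable m F1 F2 \<longleftrightarrow> (\<exists>G\<in>sets m. F1 \<subseteq> G \<and> G \<inter> F2 = {})"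

end

(* Suppose every subfamily can be separated from the complementary one.  Then
   nu(D) = m_e(UN i:D. A i) is a countably additive finite measure on all subsets of Gamma.
   Well-order Gamma and cut it at the first initial segment with non-null union, so that all
   proper initial segments have null union while the whole union E does not.  For each index i,
   cover the union over {j. j <= i} by a null G_delta set B i.  As the topology is second
   countable, {(i, y). y : B i} belongs to the product of the power set of the indices with the
   Borel sets.  It is null by Fubini, all B i being null; but for y in A j its section at y
   contains all i >= j and thus has full nu-measure, so E is null after all. *)
theory Submission
  imports Defs
begin

section \<open>Countable additivity of outer measure on separated families\<close>

lemma outer_measure_of_UN_le:
  assumes "\<And>i::nat. S i \<subseteq> space N"
  shows "outer_measure_of N (\<Union>i. S i) \<le> (\<Sum>i. outer_measure_of N (S i))"
proof -
  have "\<forall>i. \<exists>T\<in>sets N. S i \<subseteq> T \<and> outer_measure_of N (S i) = emeasure N T"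
    using outer_measure_of_attain[OF assms] by blast
  then obtain T where T: "\<And>i. T i \<in> sets N" "\<And>i. S i \<subseteq> T i"
    "\<And>i. outer_measure_of N (S i) = emeasure N (T i)"
    by metis
  have "outer_measure_of N (\<Union>i. S i) \<le> outer_measure_of N (\<Union>i. T i)"
    using T(2) by (intro outer_measure_of_mono) blast
  also have "\<dots> = emeasure N (\<Union>i. T i)"
    using T(1) by (intro outer_measure_of_eq) auto
  also have "\<dots> \<le> (\<Sum>i. emeasure N (T i))"
    using T(1) by (intro emeasure_subadditive_countably) auto
  finally show ?thesis by (simp add: T(3))
qed

text \<open>The \<open>S i\<close> need not be measurable, but the \<open>G i\<close> carve out
  disjoint measurable pieces around them. Cutting a measurable hull \<open>T\<close> of the union
  along these pieces turns superadditivity into additivity of \<open>emeasure\<close>.\<close>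

lemma outer_measure_of_UN_separated:
  fixes S G :: "nat \<Rightarrow> 'a set"
  assumes G: "\<And>i. G i \<in> sets N" "\<And>i. S i \<subseteq> G i"
    and sep: "\<And>i j. i \<noteq> j \<Longrightarrow> G i \<inter> S j = {}"
  shows "outer_measure_of N (\<Union>i. S i) = (\<Sum>i. outer_measure_of N (S i))"
proof (rule antisym)
  have S: "S i \<subseteq> space N" for i
    using G sets.sets_into_space by blast
  then show "outer_measure_of N (\<Union>i. S i) \<le> (\<Sum>i. outer_measure_of N (S i))"
    by (rule outer_measure_of_UN_le)
  from S have "(\<Union>i. S i) \<subseteq> space N" by blast
  then obtain T where T: "T \<in> sets N" "(\<Union>i. S i) \<subseteq> T"
    "outer_measure_of N (\<Union>i. S i) = emeasure N T"
    using outer_measure_of_attain[of "\<Union>i. S i" N] by metis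
  have D: "disjointed G i \<in> sets N" for i
    using sets.range_disjointed_sets[of G N] G(1) by auto
  \<comment> \<open>The \<open>G i\<close> may overlap. Making them disjoint removes only earlier
    \<open>G j\<close> from \<open>G i\<close>, and none of these meets \<open>S i\<close>.\<close>
  have SD: "S i \<subseteq> disjointed G i" for i
  proof
    fix x assume x: "x \<in> S i"
    then have "x \<notin> G j" if "j < i" for j
      using sep[of j i] that by (metis IntI emptyE less_irrefl)
    moreover have "x \<in> G i" using x G(2) by (rule rev_subsetD)
    ultimately show "x \<in> disjointed G i" by (simp add: disjointed_def)
  qed
  have "outer_measure_of N (S i) \<le> emeasure N (T \<inter> disjointed G i)" for i
  proof -
    have "outer_measure_of N (S i) \<le> outer_measure_of N (T \<inter> disjointed G i)"
      using SD[of i] T(2) by (intro outer_measure_of_mono) blast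
    then show ?thesis using T(1) D by simp
  qed
  then have "(\<Sum>i. outer_measure_of N (S i)) \<le> (\<Sum>i. emeasure N (T \<inter> disjointed G i))"
    by (intro suminf_le) auto
  also have "\<dots> = emeasure N (\<Union>i. T \<inter> disjointed G i)"
    using T(1) D disjoint_family_disjointed[of G]
    by (intro suminf_emeasure) (auto simp: disjoint_family_on_def)
  also have "\<dots> \<le> emeasure N T"
    using T(1) by (intro emeasure_mono) auto
  finally show "(\<Sum>i. outer_measure_of N (S i)) \<le> outer_measure_of N (\<Union>i. S i)"
    by (simp add: T(3))
qed

text \<open>For disjoint \<open>J n\<close>, a set separating \<open>J n\<close> from
  \<open>I - J n\<close> also separates it from every other \<open>J k\<close>, so countable
  additivity follows from the separated case. Having all of \<open>Pow I\<close> measurable is what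
  later makes arbitrary sets of indices admissible in Fubini's theorem.\<close>

lemma separable_family_measure:
  assumes space: "\<And>i. i \<in> I \<Longrightarrow> A i \<subseteq> space N"
    and sep: "\<And>J. J \<subseteq> I \<Longrightarrow> separable_by_measurable N (\<Union>i\<in>J. A i) (\<Union>i\<in>I - J. A i)"
  obtains \<nu> where "space \<nu> = I" "sets \<nu> = Pow I"
    "\<And>J. J \<subseteq> I \<Longrightarrow> emeasure \<nu> J = outer_measure_of N (\<Union>i\<in>J. A i)"
proof -
  define \<mu> where "\<mu> J = outer_measure_of N (\<Union>i\<in>J. A i)" for J
  define \<nu> where "\<nu> = measure_of I (Pow I) \<mu>"
  have sets: "sets \<nu> = Pow I" and space: "space \<nu> = I"
    by (auto simp: \<nu>_def sigma_algebra.sets_measure_of_eq[OF sigma_algebra_Pow] space_measure_of_conv)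
  have "emeasure \<nu> J = \<mu> J" if "J \<subseteq> I" for J
  proof (rule emeasure_measure_of[OF \<nu>_def])
    show "positive (sets \<nu>) \<mu>"
      by (simp add: positive_def \<mu>_def)
    show "countably_additive (sets \<nu>) \<mu>"
    proof (rule countably_additiveI)
      fix J :: "nat \<Rightarrow> _" assume J: "range J \<subseteq> sets \<nu>" "disjoint_family J"
      have JI: "J n \<subseteq> I" for n using J(1) sets by auto
      have "\<forall>n. \<exists>G\<in>sets N. (\<Union>i\<in>J n. A i) \<subseteq> G \<and> G \<inter> (\<Union>i\<in>I - J n. A i) = {}"
        using sep[OF JI] unfolding separable_by_measurable_def by blast
      then obtain G where G: "\<And>n. G n \<in> sets N" "\<And>n. (\<Union>i\<in>J n. A i) \<subseteq> G n"
        "\<And>n. G n \<inter> (\<Union>i\<in>I - J n. A i) = {}"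
        by metis
      have "G n \<inter> (\<Union>i\<in>J k. A i) = {}" if "n \<noteq> k" for n k
      proof -
        have "J k \<subseteq> I - J n"
          using J(2) that JI[of k] by (auto simp: disjoint_family_on_def)
        then show ?thesis using G(3)[of n] by blast
      qed
      from outer_measure_of_UN_separated[OF G(1,2) this]
      have "outer_measure_of N (\<Union>n. \<Union>i\<in>J n. A i) = (\<Sum>n. \<mu> (J n))"
        by (simp add: \<mu>_def)
      then show "(\<Sum>n. \<mu> (J n)) = \<mu> (\<Union>n. J n)"
        by (simp add: \<mu>_def)
    qed
  qed (use that sets in auto)
  with sets space show thesis
    by (intro that) (auto simp: \<mu>_def)
qed

section \<open>Product measurability and null G_delta covers\<close>

text \<open>Second countability enters here: \<open>y\<close> lies in \<open>U i\<close> iff some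
  basic \<open>b\<close> contains \<open>y\<close> and lies inside \<open>U i\<close>. So the set is
  a countable union of rectangles, whose index sides are measurable whatever the family
  \<open>U\<close> is.\<close>

lemma sets_pair_open_family:
  fixes U :: "'i \<Rightarrow> 'a::second_countable_topology set"
  assumes N: "sets N = Pow (space N)" and M: "sets M = sets borel"
    and U: "\<And>i. i \<in> space N \<Longrightarrow> open (U i)"
  shows "{(i, y). i \<in> space N \<and> y \<in> U i} \<in> sets (N \<Otimes>\<^sub>M M)"
proof -
  obtain B :: "'a set set" where B: "countable B" "topological_basis B"
    using ex_countable_basis by blast
  have "{(i, y). i \<in> space N \<and> y \<in> U i} = (\<Union>b\<in>B. {i\<in>space N. b \<subseteq> U i} \<times> b)"
  proof (intro set_eqI iffI; clarsimp)
    fix i y assume "i \<in> space N" "y \<in> U i"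
    then show "\<exists>b\<in>B. b \<subseteq> U i \<and> y \<in> b"
      using topological_basisE[OF B(2) U[of i], of y] by metis
  next
    fix i y b assume "b \<subseteq> U i" "y \<in> b"
    then show "y \<in> U i" by blast
  qed
  moreover have "b \<in> sets M" if "b \<in> B" for b
    using topological_basis_open[OF B(2) that] M by simp
  ultimately show ?thesis
    using B(1) N by (simp only:, intro sets.countable_UN'' pair_measureI) auto
qed

text \<open>A null cover by countably many open sets is the form to which the product measurability
  of open families applies; outer regularity supplies it.\<close>

lemma null_set_G_delta_cover:
  assumes reg: "regular_borel_measure M" and Z: "outer_measure_of (completion M) Z = 0"
  obtains U :: "nat \<Rightarrow> 'a::topological_space set"
  where "\<And>n. open (U n)" "Z \<subseteq> (\<Inter>n. U n)" "emeasure M (\<Inter>n. U n) = 0"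
proof -
  have M: "sets M = sets borel" using reg by (simp add: regular_borel_measure_def)
  then have "Z \<subseteq> space (completion M)" using sets_eq_imp_space_eq[OF M] by simp
  from outer_measure_of_attain[OF this] Z obtain Y where
    Y: "Y \<in> sets (completion M)" "Z \<subseteq> Y" "emeasure (completion M) Y = 0"
    by auto
  \<comment> \<open>Regularity concerns \<open>M\<close> itself, so the hull in the completion is
    enlarged to a null set of \<open>M\<close>.\<close>
  from completion_upper[OF Y(1)] Y(2,3) obtain C where
    C: "C \<in> sets M" "Z \<subseteq> C" "emeasure M C = 0"
    by (metis subset_trans)
  have "(INF U\<in>{U. open U \<and> C \<subseteq> U}. emeasure M U) = 0"
    using reg C by (auto simp: regular_borel_measure_def)
  \<comment> \<open>\<open>Suc n\<close> keeps the bound positive: \<open>inverse (real 0)\<close>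
    is 0, below which no measure lies.\<close>
  then have "\<exists>U. open U \<and> C \<subseteq> U \<and> emeasure M U < ennreal (inverse (real (Suc n)))" for n
    using INF_less_iff[of "emeasure M" "{U. open U \<and> C \<subseteq> U}" "ennreal (inverse (real (Suc n)))"]
    by auto
  then obtain U where U: "\<And>n. open (U n)" "\<And>n. C \<subseteq> U n"
    "\<And>n. emeasure M (U n) < ennreal (inverse (real (Suc n)))"
    by metis
  have "emeasure M (\<Inter>n. U n) \<le> 0"
  proof (rule ennreal_le_epsilon)
    fix e :: real assume "0 < e"
    then obtain n where n: "inverse (real (Suc n)) < e" using reals_Archimedean by blast
    have "emeasure M (\<Inter>n. U n) \<le> emeasure M (U n)"
      using U(1)[of n] M by (intro emeasure_mono) auto
    also have "\<dots> \<le> ennreal e"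
      using U(3)[of n] n by (meson ennreal_leI less_imp_le order_trans)
    finally show "emeasure M (\<Inter>n. U n) \<le> 0 + ennreal e" by simp
  qed
  with U(1,2) C(2) show thesis by (intro that[of U]) auto
qed

section \<open>Cutting a well-order\<close>

text \<open>Let \<open>k\<close> be the first element whose closed initial segment violates
  \<open>P\<close>; if there is none, \<open>I\<close> itself serves. Dropping \<open>k\<close>
  keeps \<open>P\<close> false, since \<open>P {k}\<close> holds and \<open>P\<close> is closed
  under unions, while minimality of \<open>k\<close> gives \<open>P\<close> for all smaller
  segments.\<close>

lemma well_order_null_segments:
  assumes Z: "\<And>i. i \<in> I \<Longrightarrow> P {i}" "\<And>J K. P J \<Longrightarrow> P K \<Longrightarrow> P (J \<union> K)" and I: "\<not> P I"
  obtains I' r where "I' \<subseteq> I" "\<not> P I'" "total_on I' r"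
    "\<And>i. i \<in> I' \<Longrightarrow> P {j\<in>I'. (j, i) \<in> r}"
proof -
  obtain r where r: "well_order_on I r" using well_order_on by blast
  then have tot: "total_on I r" and wf: "wf (r - Id)" and lin: "antisym r" "refl_on I r" "trans r"
    by (auto simp: well_order_on_def linear_order_on_def partial_order_on_def preorder_on_def)
  let ?seg = "\<lambda>i. {j\<in>I. (j, i) \<in> r}"
  show thesis
  proof (cases "\<forall>i\<in>I. P (?seg i)")
    case True
    with tot I show thesis by (intro that[of I r]) auto
  next
    case False
    then obtain k0 where "k0 \<in> {i\<in>I. \<not> P (?seg i)}" by blast
    then obtain k where k: "k \<in> {i\<in>I. \<not> P (?seg i)}"
      and "\<And>j. (j, k) \<in> r - Id \<Longrightarrow> j \<notin> {i\<in>I. \<not> P (?seg i)}"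
      by (rule wfE_min[OF wf]) blast
    then have k: "k \<in> I" "\<not> P (?seg k)"
      and min: "\<And>j. (j, k) \<in> r - Id \<Longrightarrow> j \<in> I \<Longrightarrow> P (?seg j)"
      by blast+
    define I' where "I' = ?seg k - {k}"
    have "?seg k = I' \<union> {k}"
      using k(1) lin(2) by (auto simp: I'_def refl_on_def)
    with k Z have "\<not> P I'" by metis
    moreover have "P {j\<in>I'. (j, i) \<in> r}" if "i \<in> I'" for i
    proof -
      \<comment> \<open>Transitivity places everything below \<open>i\<close> also below
        \<open>k\<close>; antisymmetry excludes \<open>k\<close> itself.\<close>
      have "{j\<in>I'. (j, i) \<in> r} = ?seg i"
        using that lin(1,3) by (auto simp: I'_def dest: transD antisymD)
      with that min[of i] show ?thesis by (auto simp: I'_def)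
    qed
    ultimately show thesis
      using tot by (intro that[of I' r]) (auto simp: I'_def total_on_def)
  qed
qed

lemma outer_measure_of_Un_null:
  assumes "outer_measure_of N S = 0" "outer_measure_of N T = 0"
    and "S \<subseteq> space N" "T \<subseteq> space N"
  shows "outer_measure_of N (S \<union> T) = 0"
proof -
  obtain S' where S': "S' \<in> null_sets N" "S \<subseteq> S'"
    using outer_measure_of_attain[OF assms(3)] assms(1) by auto
  obtain T' where T': "T' \<in> null_sets N" "T \<subseteq> T'"
    using outer_measure_of_attain[OF assms(4)] assms(2) by auto
  have "outer_measure_of N (S \<union> T) \<le> outer_measure_of N (S' \<union> T')"
    using S' T' by (intro outer_measure_of_mono) auto
  also have "\<dots> = 0" using null_sets.Un[OF S'(1) T'(1)] by (simp add: null_sets_def)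
  finally show ?thesis by simp
qed

section \<open>The Fubini argument\<close>

lemma outer_measure_null_if_null_segments:
  fixes M :: "'a::second_countable_topology measure"
  assumes fin: "finite_measure M" and reg: "regular_borel_measure M"
    and sep: "\<And>J. J \<subseteq> I \<Longrightarrow>
      separable_by_measurable (completion M) (\<Union>i\<in>J. A i) (\<Union>i\<in>I - J. A i)"
    and tot: "total_on I r"
    and seg: "\<And>i. i \<in> I \<Longrightarrow> outer_measure_of (completion M) (\<Union>j\<in>{j\<in>I. (j, i) \<in> r}. A j) = 0"
    and self: "\<And>i. i \<in> I \<Longrightarrow> outer_measure_of (completion M) (A i) = 0"
  shows "outer_measure_of (completion M) (\<Union>i\<in>I. A i) = 0"
proof (rule ccontr)
  let ?m = "completion M"
  assume pos: "outer_measure_of ?m (\<Union>i\<in>I. A i) \<noteq> 0"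
  have M: "sets M = sets borel" using reg by (simp add: regular_borel_measure_def)
  then have spM: "space M = UNIV" using sets_eq_imp_space_eq[OF M] by simp
  obtain \<nu> where sp\<nu>: "space \<nu> = I" and sets\<nu>: "sets \<nu> = Pow I"
    and \<nu>: "\<And>J. J \<subseteq> I \<Longrightarrow> emeasure \<nu> J = outer_measure_of ?m (\<Union>i\<in>J. A i)"
    by (rule separable_family_measure[of I A ?m]) (use sep spM in auto)
  \<comment> \<open>\<open>A i\<close> is added by hand because \<open>r\<close> is only assumed
    total, which compares distinct indices and does not give reflexivity.\<close>
  define L where "L i = A i \<union> (\<Union>j\<in>{j\<in>I. (j, i) \<in> r}. A j)" for i
  have L: "outer_measure_of ?m (L i) = 0" if "i \<in> I" for i
    unfolding L_def using self[OF that] seg[OF that] spM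
    by (intro outer_measure_of_Un_null) auto
  have "\<forall>i\<in>I. \<exists>U::nat \<Rightarrow> 'a set.
      (\<forall>n. open (U n)) \<and> L i \<subseteq> (\<Inter>n. U n) \<and> emeasure M (\<Inter>n. U n) = 0"
    using null_set_G_delta_cover[OF reg L] by metis
  from bchoice[OF this] obtain U :: "_ \<Rightarrow> nat \<Rightarrow> 'a set" where
    U: "\<And>i n. i \<in> I \<Longrightarrow> open (U i n)" "\<And>i. i \<in> I \<Longrightarrow> L i \<subseteq> (\<Inter>n. U i n)"
      "\<And>i. i \<in> I \<Longrightarrow> emeasure M (\<Inter>n. U i n) = 0"
    by metis
  \<comment> \<open>Each level \<open>n\<close> is a family of open sets, hence measurable in the
    product. The section at \<open>i\<close> is the null G_delta cover of
    \<open>L i\<close>.\<close>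
  define D where "D = (\<Inter>n. {(i, y). i \<in> space \<nu> \<and> y \<in> U i n})"
  interpret M: finite_measure M by fact
  \<comment> \<open>Exchanging the order of integration needs both factors sigma-finite;
    \<open>\<nu>\<close> is bounded by the total mass of \<open>M\<close>.\<close>
  interpret \<nu>: finite_measure \<nu>
  proof
    have "outer_measure_of ?m (\<Union>i\<in>I. A i) \<le> outer_measure_of ?m (space ?m)"
      using spM by (intro outer_measure_of_mono) auto
    also have "\<dots> < top"
      using M.emeasure_finite[of "space M"] by (simp add: less_top[symmetric])
    finally show "emeasure \<nu> (space \<nu>) \<noteq> \<infinity>" using \<nu>[of I] sp\<nu> by auto
  qed
  interpret pair_sigma_finite \<nu> M ..
  have D: "D \<in> sets (\<nu> \<Otimes>\<^sub>M M)"
    unfolding D_def using sets\<nu> sp\<nu> U(1) M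
    by (intro sets.countable_INT) (auto intro!: sets_pair_open_family)
  have "emeasure M (Pair i -` D) = 0" if "i \<in> space \<nu>" for i
  proof -
    have "Pair i -` D = (\<Inter>n. U i n)" using that by (auto simp: D_def)
    with U(3) that sp\<nu> show ?thesis by simp
  qed
  then have "emeasure (\<nu> \<Otimes>\<^sub>M M) D = 0"
    by (simp add: M.emeasure_pair_measure_alt[OF D] cong: nn_integral_cong)
  then have "(\<integral>\<^sup>+y. emeasure \<nu> ((\<lambda>i. (i, y)) -` D) \<partial>M) = 0"
    using emeasure_pair_measure_alt2[OF D] by simp
  then have ae: "AE y in M. emeasure \<nu> ((\<lambda>i. (i, y)) -` D) = 0"
    using nn_integral_0_iff_AE measurable_emeasure_Pair2[OF D] by blast
  then obtain N where N: "N \<in> null_sets M"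
      "{y\<in>space M. emeasure \<nu> ((\<lambda>i. (i, y)) -` D) \<noteq> 0} \<subseteq> N"
    by (auto simp: eventually_ae_filter)
  have "emeasure \<nu> ((\<lambda>i. (i, y)) -` D) \<noteq> 0" if i: "i \<in> I" and y: "y \<in> A i" for i y
  proof
    assume "emeasure \<nu> ((\<lambda>i. (i, y)) -` D) = 0"
    moreover have "(\<lambda>i. (i, y)) -` D \<in> sets \<nu>"
      using sets\<nu> sp\<nu> by (auto simp: D_def)
    ultimately have 1: "(\<lambda>i. (i, y)) -` D \<in> null_sets \<nu>" by auto
    have 2: "{j\<in>I. (j, i) \<in> r} \<in> null_sets \<nu>"
      using \<nu>[of "{j\<in>I. (j, i) \<in> r}"] seg[OF i] sets\<nu> by auto
    \<comment> \<open>If \<open>j\<close> is not below \<open>i\<close>, totality gives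
      \<open>i = j\<close> or \<open>i\<close> below \<open>j\<close>, so \<open>A i\<close> is part
      of \<open>L j\<close>. Hence the section at \<open>y\<close> misses at most a
      \<open>\<nu>\<close>-null segment of \<open>I\<close>.\<close>
    have "(j, y) \<in> D" if "j \<in> I" "(j, i) \<notin> r" for j
    proof -
      have "y \<in> L j"
        using tot that i y by (cases "i = j") (auto simp: L_def total_on_def)
      with U(2)[of j] that sp\<nu> show ?thesis by (auto simp: D_def)
    qed
    then have "I \<subseteq> (\<lambda>i. (i, y)) -` D \<union> {j\<in>I. (j, i) \<in> r}" by auto
    with null_sets.Un[OF 1 2] sets\<nu> have "I \<in> null_sets \<nu>"
      by (metis Pow_top null_sets_subset)
    with pos \<nu>[of I] show False by auto
  qed
  with N(2) spM have "(\<Union>i\<in>I. A i) \<subseteq> N" by blast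
  then have "outer_measure_of ?m (\<Union>i\<in>I. A i) \<le> outer_measure_of ?m N"
    by (rule outer_measure_of_mono)
  also have "\<dots> = 0" using N(1) by (simp add: null_sets_def)
  finally show False using pos by simp
qed

theorem theorem5p7:
  fixes M m :: "'a::second_countable_topology measure"
    and A :: "'i \<Rightarrow> 'a set" and \<Gamma> :: "'i set" and E :: "'a set"
  assumes "finite_measure M"
    and "regular_borel_measure M"
    and "m = completion M"
    and "disjoint_family_on A \<Gamma>"
    and "\<forall>\<gamma>\<in>\<Gamma>. A \<gamma> \<in> sets m \<and> emeasure m (A \<gamma>) = 0"
    and "E = (\<Union>\<gamma>\<in>\<Gamma>. A \<gamma>)"
    and "outer_measure_of m E > 0"
  shows "\<exists>\<Delta>\<subseteq>\<Gamma>. \<not> separable_by_measurable m (\<Union>\<gamma>\<in>\<Delta>. A \<gamma>) (\<Union>\<gamma>\<in>\<Gamma> - \<Delta>. A \<gamma>)"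
proof (rule ccontr)
  assume "\<not> ?thesis"
  then have sep: "separable_by_measurable m (\<Union>\<gamma>\<in>\<Delta>. A \<gamma>) (\<Union>\<gamma>\<in>\<Gamma> - \<Delta>. A \<gamma>)" if "\<Delta> \<subseteq> \<Gamma>" for \<Delta>
    using that by blast
  have sp: "space m = UNIV"
    using assms(2,3) sets_eq_imp_space_eq[of M borel] by (simp add: regular_borel_measure_def)
  \<comment> \<open>Index sets with null union contain all singletons and are closed under binary
    unions, but exclude \<open>\<Gamma>\<close>: just what cutting the well-order requires.\<close>
  let ?P = "\<lambda>J. outer_measure_of m (\<Union>\<gamma>\<in>J. A \<gamma>) = 0"
  have null: "outer_measure_of m (A \<gamma>) = 0" if "\<gamma> \<in> \<Gamma>" for \<gamma>
    using assms(5) that by simp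
  then have 1: "?P {\<gamma>}" if "\<gamma> \<in> \<Gamma>" for \<gamma>
    using that by simp
  have 2: "?P (J \<union> K)" if "?P J" "?P K" for J K
    using outer_measure_of_Un_null[OF that] sp by simp
  have 3: "\<not> ?P \<Gamma>" using assms(6,7) by simp
  obtain I r where
    I: "I \<subseteq> \<Gamma>" "\<not> ?P I" "total_on I r" "\<And>i. i \<in> I \<Longrightarrow> ?P {j\<in>I. (j, i) \<in> r}"
    by (rule well_order_null_segments[of \<Gamma> ?P, OF 1 2 3]) (assumption+, rule that)
  \<comment> \<open>Separability descends from \<open>\<Gamma>\<close> to \<open>I\<close>: the same
    \<open>G\<close> works, as \<open>I - J\<close> is contained in
    \<open>\<Gamma> - J\<close>.\<close>
  have sepI: "separable_by_measurable (completion M) (\<Union>i\<in>J. A i) (\<Union>i\<in>I - J. A i)"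
    if "J \<subseteq> I" for J
  proof -
    from that I(1) have "J \<subseteq> \<Gamma>" by simp
    from sep[OF this] obtain G where
      G: "G \<in> sets m" "(\<Union>i\<in>J. A i) \<subseteq> G" "G \<inter> (\<Union>i\<in>\<Gamma> - J. A i) = {}"
      unfolding separable_by_measurable_def by (elim bexE conjE)
    have "(\<Union>i\<in>I - J. A i) \<subseteq> (\<Union>i\<in>\<Gamma> - J. A i)"
      using I(1) by (intro UN_mono) auto
    with G(3) have "G \<inter> (\<Union>i\<in>I - J. A i) = {}"
      by (metis Int_mono order_refl subset_empty)
    with G(1,2) assms(3) show ?thesis
      unfolding separable_by_measurable_def by (intro bexI[of _ G] conjI) simp_all
  qed
  have "outer_measure_of (completion M) (\<Union>i\<in>I. A i) = 0"
    using assms(1,2) sepI I(3)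
  proof (rule outer_measure_null_if_null_segments)
    fix i assume i: "i \<in> I"
    show "outer_measure_of (completion M) (\<Union>j\<in>{j\<in>I. (j, i) \<in> r}. A j) = 0"
      using I(4)[OF i] by (simp only: assms(3))
    show "outer_measure_of (completion M) (A i) = 0"
      using null[of i] i I(1) by (auto simp only: assms(3))
  qed
  with I(2) assms(3) show False by simp
qed

end
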